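(* Let $X$ be a compact metrizable space, $f:X\to X$ a continuous map, and let $T_f:X^{\mathbb{Z}}\to X^{\mathbb{Z}}$, $T_f((x_k)_{k\in\mathbb{Z}})=(f(x_{k+1}))_{k\in\mathbb{Z}}$, be the associated unit cellular automaton. Let $(\widetilde{X_f},\widetilde{f})$ be the natural extension of $(X,f)$ and let $T_{\widetilde f}$ be the unit cellular automaton on $\widetilde{X_f}^{\,\mathbb{Z}}$, $T_{\widetilde f}((\tilde x_k)_{k\in\mathbb{Z}})=(\widetilde f(\tilde x_{k+1}))_{k\in\mathbb{Z}}$. Then the natural extension $(\widetilde{X^{\mathbb{Z}}_{T_f}}, \widetilde{T_f})$ of $(X^{\mathbb{Z}},T_f)$ is topologically conjugate to $(\widetilde{X_f}^{\,\mathbb{Z}}, T_{\widetilde{f}})$.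
   Context: Natural extension: for a compact metrizable space $Z$ and a continuous map $T:Z\to Z$, $\widetilde{Z_T}$ is the set of sequences $(z_k)_{k\in\mathbb{N}}$ with $z_k\in\bigcap_{n\ge0}T^nZ$ and $T(z_{k+1})=z_k$ for all $k$, with the topology induced from $Z^{\mathbb{N}}$, and $\widetilde{T}$ is the homeomorphism $(z_k)_{k\in\mathbb{N}}\mapsto(Tz_0,z_0,z_1,\dots)$ of $\widetilde{Z_T}$. *)

theory Defs
  imports "HOL-Analysis.Analysis"
begin

text \<open>Spaces are elements of the type of topologies, so that the phase space may be any
  topological space rather than a whole type. A dynamical system is a pair of a topology \<open>Z\<close> and a
  function \<open>T\<close>, whose values matter only on \<open>topspace Z\<close>.\<close>

text \<open>The subspace of \<open>Z\<^sup>\<nat>\<close> (with \<open>0 \<in> \<nat>\<close>) underlying the natural extension of \<open>(Z, T)\<close>.\<close>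

definition natural_extension :: "'a topology \<Rightarrow> ('a \<Rightarrow> 'a) \<Rightarrow> (nat \<Rightarrow> 'a) topology" where
  "natural_extension Z T =
     subtopology (product_topology (\<lambda>_. Z) UNIV)
       {z. (\<forall>k. z k \<in> (\<Inter>n. (T ^^ n) ` topspace Z)) \<and> (\<forall>k. T (z (Suc k)) = z k)}"

definition natural_extension_map :: "('a \<Rightarrow> 'a) \<Rightarrow> (nat \<Rightarrow> 'a) \<Rightarrow> (nat \<Rightarrow> 'a)" where
  "natural_extension_map T z = (\<lambda>k. case k of 0 \<Rightarrow> T (z 0) | Suc j \<Rightarrow> z j)"

definition bi_sequences :: "'a topology \<Rightarrow> (int \<Rightarrow> 'a) topology" where
  "bi_sequences X = product_topology (\<lambda>_. X) UNIV"

definition unit_CA :: "('a \<Rightarrow> 'a) \<Rightarrow> (int \<Rightarrow> 'a) \<Rightarrow> (int \<Rightarrow> 'a)" where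
  "unit_CA f x = (\<lambda>k. f (x (k + 1)))"

definition topologically_conjugate ::
    "'a topology \<Rightarrow> ('a \<Rightarrow> 'a) \<Rightarrow> 'b topology \<Rightarrow> ('b \<Rightarrow> 'b) \<Rightarrow> bool" where
  "topologically_conjugate X S Y T \<longleftrightarrow>
     (\<exists>h. homeomorphic_map X Y h \<and> (\<forall>x \<in> topspace X. h (S x) = T (h x)))"

end

theory Submission
  imports Defs
begin

text \<open>A point of the natural extension of the cellular automaton is a family \<open>w j k\<close> of points of
  \<open>X\<close>, where \<open>j \<in> \<nat>\<close> counts steps into the past and \<open>k \<in> \<int>\<close> is the site, subject to
  \<open>f (w (j + 1) (k + 1)) = w j k\<close>. A bi-infinite sequence of points of the natural extension of
  \<open>(X, f)\<close> is a family \<open>v k j\<close> subject to \<open>f (v k (j + 1)) = v k j\<close>. The automaton applies \<open>f\<close> along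
  the diagonals of the array, so the shear \<open>v k j = w j (k + j)\<close>, which makes these diagonals
  vertical, carries the first condition to the second. Both spaces have the topology of
  convergence of every entry, which a permutation of the entries respects, and the shear also
  intertwines the two maps.

  The definition of the natural extension asks in addition that every coordinate lies in
  \<open>\<Inter>n. T\<^sup>n Z\<close>. This follows from the recursion \<open>T (z (k + 1)) = z k\<close>, since \<open>z k = T\<^sup>n (z (k + n))\<close>;
  hence the eventual images of the automaton never have to be compared with those of \<open>f\<close>.\<close>

lemma backward_orbit_funpow:
  assumes "\<And>k. T (z (Suc k)) = z k"
  shows "(T ^^ n) (z (k + n)) = z k"
  by (induction n) (simp_all add: assms funpow_swap1)

text \<open>Membership in the eventual image is automatic for a backward orbit, because its entries
  further back are preimages of all orders.\<close>

lemma topspace_natural_extension: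
  "topspace (natural_extension Z T) =
     {z. (\<forall>k. z k \<in> topspace Z) \<and> (\<forall>k. T (z (Suc k)) = z k)}"
proof -
  have "z k \<in> (T ^^ n) ` topspace Z"
    if "\<forall>k. z k \<in> topspace Z" "\<forall>k. T (z (Suc k)) = z k" for z k n
    using that backward_orbit_funpow[of T z n k] by (metis image_eqI)
  then show ?thesis
    by (auto simp: natural_extension_def PiE_UNIV_domain)
qed

lemma continuous_map_into_natural_extension:
  assumes "\<And>k. continuous_map Y Z (\<lambda>y. g y k)"
    and "\<And>y k. y \<in> topspace Y \<Longrightarrow> T (g y (Suc k)) = g y k"
  shows "continuous_map Y (natural_extension Z T) g"
proof -
  have "g y \<in> topspace (natural_extension Z T)" if "y \<in> topspace Y" for y
    using that assms by (auto simp: topspace_natural_extension continuous_map_def Pi_iff)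
  then show ?thesis
    using assms(1) unfolding natural_extension_def
    by (auto simp: continuous_map_in_subtopology continuous_map_componentwise_UNIV)
qed

lemma continuous_map_natural_extension_coordinate:
  "continuous_map (natural_extension Z T) Z (\<lambda>z. z k)"
  unfolding natural_extension_def
  by (intro continuous_map_from_subtopology continuous_map_product_projection) simp

lemma topspace_bi_sequences: "topspace (bi_sequences X) = {x. \<forall>k. x k \<in> topspace X}"
  by (auto simp: bi_sequences_def PiE_UNIV_domain)

lemma continuous_map_bi_sequences_iff:
  "continuous_map Y (bi_sequences X) g \<longleftrightarrow> (\<forall>k. continuous_map Y X (\<lambda>y. g y k))"
  by (simp add: bi_sequences_def continuous_map_componentwise_UNIV)

lemma continuous_map_bi_sequences_coordinate: "continuous_map (bi_sequences X) X (\<lambda>x. x k)"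
  unfolding bi_sequences_def by (rule continuous_map_product_projection) simp

definition shear :: "(nat \<Rightarrow> int \<Rightarrow> 'a) \<Rightarrow> int \<Rightarrow> nat \<Rightarrow> 'a" where
  "shear w = (\<lambda>k j. w j (k + int j))"

definition unshear :: "(int \<Rightarrow> nat \<Rightarrow> 'a) \<Rightarrow> nat \<Rightarrow> int \<Rightarrow> 'a" where
  "unshear v = (\<lambda>j k. v (k - int j) j)"

lemma unshear_shear [simp]: "unshear (shear w) = w"
  by (simp add: shear_def unshear_def)

lemma shear_unshear [simp]: "shear (unshear v) = v"
  by (simp add: shear_def unshear_def)

lemma shear_recursion:
  assumes "\<And>j. unit_CA f (w (Suc j)) = w j"
  shows "f (shear w k (Suc j)) = shear w k j"
  using fun_cong[OF assms, of j "k + int j"]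
  by (simp add: shear_def unit_CA_def algebra_simps)

lemma unshear_recursion:
  assumes "\<And>k j. f (v k (Suc j)) = v k j"
  shows "unit_CA f (unshear v (Suc j)) = unshear v j"
  by (simp add: unshear_def unit_CA_def assms)

text \<open>Moving one step forward in time turns \<open>w j\<close> into the entry with index \<open>j + 1\<close> at the same
  site. In sheared coordinates that entry, at site \<open>k + (j + 1)\<close>, is \<open>shear w (k + 1) j\<close>, so the
  time step becomes a shift of the sites together with a time step of the natural extension of
  \<open>f\<close>. At \<open>j = 0\<close> both sides apply \<open>f\<close> to the present entry at the next site.\<close>

lemma shear_natural_extension_map:
  "shear (natural_extension_map (unit_CA f) w) = unit_CA (natural_extension_map f) (shear w)"
  by (auto simp: shear_def unit_CA_def natural_extension_map_def fun_eq_iff algebra_simps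
      split: nat.split)

lemma homeomorphic_maps_shear:
  "homeomorphic_maps (natural_extension (bi_sequences X) (unit_CA f))
     (bi_sequences (natural_extension X f)) shear unshear"
proof -
  let ?E = "natural_extension (bi_sequences X) (unit_CA f)"
  let ?B = "bi_sequences (natural_extension X f)"
  have entry_E: "continuous_map ?E X (\<lambda>w. w j k)" for j k
    using continuous_map_compose[OF continuous_map_natural_extension_coordinate
        continuous_map_bi_sequences_coordinate] by (simp add: o_def)
  have entry_B: "continuous_map ?B X (\<lambda>v. v k j)" for k j
    using continuous_map_compose[OF continuous_map_bi_sequences_coordinate
        continuous_map_natural_extension_coordinate] by (simp add: o_def)
  have "continuous_map ?E ?B shear"
    unfolding continuous_map_bi_sequences_iff
  proof (intro allI continuous_map_into_natural_extension)
    show "continuous_map ?E X (\<lambda>w. shear w k j)" for k j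
      unfolding shear_def by (rule entry_E)
    show "f (shear w k (Suc j)) = shear w k j" if "w \<in> topspace ?E" for w k j
      using that by (intro shear_recursion) (simp add: topspace_natural_extension)
  qed
  moreover have "continuous_map ?B ?E unshear"
  proof (intro continuous_map_into_natural_extension)
    show "continuous_map ?B (bi_sequences X) (\<lambda>v. unshear v j)" for j
      unfolding continuous_map_bi_sequences_iff unshear_def by (intro allI entry_B)
    show "unit_CA f (unshear v (Suc j)) = unshear v j" if "v \<in> topspace ?B" for v j
      using that
      by (intro unshear_recursion) (simp add: topspace_bi_sequences topspace_natural_extension)
  qed
  ultimately show ?thesis
    by (simp add: homeomorphic_maps_def)
qed

theorem proposition6p2:
  fixes X :: "'a topology" and f :: "'a \<Rightarrow> 'a"
  assumes "compact_space X" and "metrizable_space X" and "continuous_map X X f"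
  shows "topologically_conjugate
           (natural_extension (bi_sequences X) (unit_CA f)) (natural_extension_map (unit_CA f))
           (bi_sequences (natural_extension X f)) (unit_CA (natural_extension_map f))"
  unfolding topologically_conjugate_def
  using homeomorphic_maps_shear[of X f] shear_natural_extension_map[of f]
  by (metis homeomorphic_map_maps)

end
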